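(* Let $a:(0,\infty)\to(0,\infty)$ be a continuous function such that $\lim_{t\to\infty}\int_t^{t+\eta}a(s)\,ds>0$ for some $\eta>0$. Let $b:\mathbb{R}\to[0,\infty)$ be a continuous function for which there exist $-\infty\le l<\infty$ and $-\infty<r<\infty$ such that $b>0$ and $b$ is locally Lipschitz on $(l,\infty)$, and $b:[r,\infty)\to(0,\infty)$ is non-decreasing. Let $x_0>l$, $t_0\ge 0$, and consider the ordinary differential equation $$\frac{dy(t)}{dt}=a(t)\,b(y(t)),\quad t>t_0,\qquad y(t_0)=x_0 .$$ Put $A_{t_0}(x)=\int_{t_0}^x a(z)\,dz$ for $x\in(t_0,\infty)$ and $B_{x_0}(x)=\int_{x_0}^x\frac{dz}{b(z)}$ for $x\in(l,\infty)$. (a) If $B_{x_0}(\infty)\ge A_{t_0}(\infty)$, then $y(t)=B_{x_0}^{-1}(A_{t_0}(t))$ for all $t\ge t_0$. (b) If $B_{x_0}(\infty)<A_{t_0}(\infty)$, then there is blow-up in finite time and the time of explosion $T_{x_0}^y$ of $y$ is equal to $A_{t_0}^{-1}(B_{x_0}(\infty))$.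
   Context: $A_{t_0}(\infty)$ and $B_{x_0}(\infty)$ are the limits in $(0,\infty]$ as the argument tends to $\infty$, and $A_{t_0}(t_0)=0$. For $t_0=0$ it is understood that $a$ is integrable near $0$, so that $A_0$ is a finite function. $y$ is the maximal solution, and its time of explosion $T_{x_0}^y$ is the first time at which $y$ leaves $\mathbb{R}$ (becomes infinite). *)

theory Defs
  imports "HOL-Analysis.Analysis"
begin

text \<open>
  A solution lives on \<open>[t0, T)\<close> with \<open>T \<in> (t0, \<infinity>]\<close>; the values of \<open>y\<close> elsewhere are irrelevant.
  The equation is required only for \<open>t > t0\<close>, since \<open>a\<close> may be singular at \<open>t0 = 0\<close>;
  the initial value is attained continuously.
\<close>

definition ode_solution ::
  "(real \<Rightarrow> real) \<Rightarrow> (real \<Rightarrow> real) \<Rightarrow> real \<Rightarrow> real \<Rightarrow> (real \<Rightarrow> real) \<Rightarrow> ereal \<Rightarrow> bool" where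
  "ode_solution a b t0 x0 y T \<longleftrightarrow>
     ereal t0 < T \<and> y t0 = x0 \<and>
     continuous_on {t. t0 \<le> t \<and> ereal t < T} y \<and>
     (\<forall>t. t0 < t \<and> ereal t < T \<longrightarrow> (y has_real_derivative a t * b (y t)) (at t))"

definition maximal_ode_solution ::
  "(real \<Rightarrow> real) \<Rightarrow> (real \<Rightarrow> real) \<Rightarrow> real \<Rightarrow> real \<Rightarrow> (real \<Rightarrow> real) \<Rightarrow> ereal \<Rightarrow> bool" where
  "maximal_ode_solution a b t0 x0 y T \<longleftrightarrow>
     ode_solution a b t0 x0 y T \<and>
     (\<forall>z S. ode_solution a b t0 x0 z S \<and> (\<forall>t. t0 \<le> t \<and> ereal t < T \<and> ereal t < S \<longrightarrow> z t = y t)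
        \<longrightarrow> S \<le> T)"

text \<open>
  The first time at which \<open>y\<close>, a function on \<open>[t0, T)\<close>, becomes infinite;
  it is \<open>\<infinity>\<close> (the infimum of the empty set) if this never happens.
\<close>

definition explosion_time :: "real \<Rightarrow> (real \<Rightarrow> real) \<Rightarrow> ereal \<Rightarrow> ereal" where
  "explosion_time t0 y T =
     Inf {ereal s | s. t0 < s \<and> ereal s \<le> T \<and> filterlim (\<lambda>u. \<bar>y u\<bar>) at_top (at_left s)}"

text \<open>
  The interval integral is over the open interval between its bounds, so the value of \<open>a\<close>
  at \<open>0\<close> plays no role, and it is signed, so that \<open>B_int b x0 x \<le> 0\<close> for \<open>x \<le> x0\<close>.
\<close>

definition A_int :: "(real \<Rightarrow> real) \<Rightarrow> real \<Rightarrow> real \<Rightarrow> real" where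
  "A_int a t0 x = (LBINT z=ereal t0..ereal x. a z)"

definition B_int :: "(real \<Rightarrow> real) \<Rightarrow> real \<Rightarrow> real \<Rightarrow> real" where
  "B_int b x0 x = (LBINT z=ereal x0..ereal x. 1 / b z)"

definition val_at_infty :: "(real \<Rightarrow> real) \<Rightarrow> ereal" where
  "val_at_infty F = Lim at_top (\<lambda>x. ereal (F x))"

end

theory Submission
  imports Defs
begin

text \<open>
  The equation separates: \<open>B(x) = \<integral> dz / b(z)\<close> turns \<open>y' = a b(y)\<close> into \<open>(B \<circ> y)' = a = A'\<close>, so that
  \<open>B (y t) = A t\<close> as long as \<open>y\<close> lives (\<open>solution_conserves\<close>). This is legitimate because \<open>y\<close> is
  non-decreasing, hence never leaves \<open>(l, \<infinity>)\<close>, where \<open>b\<close> is positive and \<open>B\<close> is strictly increasing.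
  Conversely, \<open>B\<^sup>-\<^sup>1 \<circ> A\<close> is a solution on every interval \<open>[t0, S)\<close> on which \<open>A\<close> stays below
  \<open>B(\<infinity>)\<close>, since there its values are values of \<open>B\<close> (\<open>inverse_comp_solves\<close>).

  Since \<open>B\<close> never attains its supremum \<open>B(\<infinity>)\<close>, the first fact gives \<open>A < B(\<infinity>)\<close> on \<open>[t0, T)\<close>.
  If \<open>T\<close> is finite, then \<open>A T \<le> B(\<infinity>)\<close> by continuity, and strict inequality would allow \<open>B\<^sup>-\<^sup>1 \<circ> A\<close>
  to continue \<open>y\<close> beyond \<open>T\<close>, against maximality. So a finite \<open>T\<close> satisfies \<open>A T = B(\<infinity>)\<close>
  (\<open>maximal_solution_end\<close>). As \<open>A\<close> is strictly increasing too, it stays below \<open>A(\<infinity>)\<close>, and this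
  equation has no solution if \<open>B(\<infinity>) \<ge> A(\<infinity>)\<close>: then \<open>T = \<infinity>\<close>. If \<open>B(\<infinity>) < A(\<infinity>)\<close>, then \<open>A\<close>
  eventually exceeds \<open>B(\<infinity>)\<close>, so \<open>T\<close> is finite and the only solution of \<open>A T = B(\<infinity>)\<close>.
  In that case \<open>B (y t) = A t \<rightarrow> B(\<infinity>)\<close> as \<open>t \<rightarrow> T\<close> forces \<open>y t \<rightarrow> \<infinity>\<close>, and \<open>T\<close> is the first
  time at which this happens because \<open>y\<close> is continuous before \<open>T\<close>.
\<close>

section \<open>Limits at infinity of strictly increasing functions\<close>

text \<open>
  The limit is the supremum over any half-line, and strict monotonicity keeps it from being attained.
\<close>

lemma
  fixes F :: "real \<Rightarrow> real"
  assumes F: "strict_mono_on {c..} F"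
  shows less_val_at_infty: "c \<le> x \<Longrightarrow> ereal (F x) < val_at_infty F"
    and less_val_at_inftyE: "v < val_at_infty F \<Longrightarrow> \<exists>x\<ge>c. v < ereal (F x)"
proof -
  define S where "S = (SUP x\<in>{c..}. ereal (F x))"
  have mono: "F x \<le> F z" if "c \<le> x" "x \<le> z" for x z
    using strict_mono_on_leD[OF F, of x z] that by auto
  have le: "ereal (F x) \<le> S" if "c \<le> x" for x
    using that unfolding S_def by (intro SUP_upper) auto
  have "((\<lambda>x. ereal (F x)) \<longlongrightarrow> S) at_top"
  proof (rule order_tendstoI)
    fix v assume "v < S"
    then obtain x where x: "c \<le> x" "v < ereal (F x)"
      unfolding S_def less_SUP_iff by auto
    show "eventually (\<lambda>z. v < ereal (F z)) at_top"
      using eventually_ge_at_top[of x]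
    proof eventually_elim
      case (elim z)
      then show ?case
        using x mono[of x z] by (metis ereal_less_eq(3) less_le_trans)
    qed
  next
    fix v assume "S < v"
    show "eventually (\<lambda>z. ereal (F z) < v) at_top"
      using eventually_ge_at_top[of c]
      by eventually_elim (use le \<open>S < v\<close> in \<open>auto intro: le_less_trans\<close>)
  qed
  then have S: "val_at_infty F = S"
    unfolding val_at_infty_def by (intro tendsto_Lim) auto
  show "ereal (F x) < val_at_infty F" if "c \<le> x"
  proof -
    have "ereal (F x) < ereal (F (x + 1))"
      using strict_mono_onD[OF F, of x "x + 1"] that by auto
    also have "\<dots> \<le> S" using that by (intro le) auto
    finally show ?thesis by (simp add: S)
  qed
  show "\<exists>x\<ge>c. v < ereal (F x)" if "v < val_at_infty F"
    using that unfolding S S_def less_SUP_iff by auto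
qed

section \<open>The two primitives\<close>

text \<open>
  A singularity at the origin is harmless once \<open>a\<close> is integrable next to it: up to a null set, what
  remains is a compact interval on which \<open>a\<close> is continuous.
\<close>

lemma set_integrable_from_origin:
  fixes a :: "real \<Rightarrow> real"
  assumes cont: "continuous_on {0<..} a" and "\<epsilon> > 0" and int: "set_integrable lborel {0<..<\<epsilon>} a"
  shows "set_integrable lborel {0..M} a"
proof -
  have "set_integrable lborel {\<epsilon>..M} a"
    by (intro borel_integrable_atLeastAtMost' continuous_on_subset[OF cont]) (use \<open>\<epsilon> > 0\<close> in auto)
  moreover have "set_integrable lborel {0..0} a"
    by (intro borel_integrable_atLeastAtMost') auto
  ultimately have "set_integrable lborel ({0..0} \<union> ({0<..<\<epsilon>} \<union> {\<epsilon>..M})) a"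
    using int by (intro set_integrable_Un) auto
  then show ?thesis
    by (rule set_integrable_subset) auto
qed

context
  fixes a :: "real \<Rightarrow> real" and t0 :: real
  assumes int: "\<And>M. set_integrable lborel {t0..M} a"
begin

lemma A_int_eq_integral: "t0 \<le> x \<Longrightarrow> A_int a t0 x = integral {t0..x} a"
  unfolding A_int_def by (intro interval_integral_eq_integral int)

text \<open>
  Differentiability yields continuity only beyond \<open>t0\<close>; at \<open>t0\<close> itself it comes from integrability.
\<close>

lemma A_int_continuous_on: "continuous_on {t0..} (A_int a t0)"
  unfolding continuous_on_eq_continuous_within
proof
  fix x assume x: "x \<in> {t0..}"
  have "continuous_on {t0..x + 1} (\<lambda>u. integral {t0..u} a)"
    using set_borel_integral_eq_integral(1)[OF int] by (intro indefinite_integral_continuous_1)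
  then have "continuous_on {t0..x + 1} (A_int a t0)"
    by (rule continuous_on_eq) (auto simp: A_int_eq_integral)
  then have "continuous (at x within {t0..x + 1}) (A_int a t0)"
    using x by (auto simp: continuous_on_eq_continuous_within)
  moreover have "at x within {t0..} = at x within {t0..x + 1}"
    by (rule at_within_nhd[of x "{x - 1<..<x + 1}"]) auto
  ultimately show "continuous (at x within {t0..}) (A_int a t0)"
    by simp
qed

lemma A_int_has_derivative:
  assumes cont: "continuous_on {t0<..} a" and t: "t0 < t"
  shows "(A_int a t0 has_real_derivative a t) (at t)"
proof -
  have "isCont a t"
    using cont t by (simp add: continuous_on_eq_continuous_at)
  then have "continuous (at t within {t0..t + 1}) a"
    by (rule continuous_at_imp_continuous_at_within)
  then have "((\<lambda>u. integral {t0..u} a) has_vector_derivative a t) (at t within {t0..t + 1})"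
    using integral_has_vector_derivative_continuous_at[of a t0 "t + 1" t "{}"] t
      set_borel_integral_eq_integral(1)[OF int] by auto
  then have "((\<lambda>u. integral {t0..u} a) has_real_derivative a t) (at t)"
    using t by (simp add: at_within_Icc_at has_real_derivative_iff_has_vector_derivative)
  then show ?thesis
    by (rule has_field_derivative_transform_within_open[of _ _ _ "{t0<..}"])
       (use t in \<open>auto simp: A_int_eq_integral\<close>)
qed

lemma A_int_strict_mono:
  assumes cont: "continuous_on {t0<..} a" and pos: "\<And>t. t0 < t \<Longrightarrow> a t > 0"
  shows "strict_mono_on {t0..} (A_int a t0)"
proof (rule strict_mono_onI)
  fix s t assume st: "s \<in> {t0..}" "t \<in> {t0..}" "s < t"
  show "A_int a t0 s < A_int a t0 t"
  proof (rule DERIV_pos_imp_increasing_open[OF \<open>s < t\<close>])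
    fix u assume "s < u" "u < t"
    then show "\<exists>D. (A_int a t0 has_real_derivative D) (at u) \<and> D > 0"
      using A_int_has_derivative[OF cont, of u] pos[of u] st by auto
  next
    show "continuous_on {s..t} (A_int a t0)"
      by (rule continuous_on_subset[OF A_int_continuous_on]) (use st in auto)
  qed
qed

end

lemma A_int_start: "A_int a t0 t0 = 0"
  by (simp add: A_int_def)

lemma B_int_start: "B_int b x0 x0 = 0"
  by (simp add: B_int_def)

lemma B_int_has_derivative:
  assumes cont: "continuous_on UNIV b" and pos: "\<And>x. l < ereal x \<Longrightarrow> b x > 0"
    and x0: "l < ereal x0" and x: "l < ereal x"
  shows "(B_int b x0 has_real_derivative 1 / b x) (at x)"
proof -
  have "l < ereal (min x0 x)"
    using x0 x by (auto simp: min_def)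
  then obtain p where p: "l < ereal p" "p < min x0 x"
    using ereal_dense2 by (metis ereal_less(2) less_ereal.simps(1))
  define q where "q = max x0 x + 1"
  have D: "l < ereal z" if "p \<le> z" for z
    using p(1) that by (metis ereal_less_eq(3) less_le_trans)
  have "continuous_on {p..q} (\<lambda>z. 1 / b z)"
    by (intro continuous_intros continuous_on_subset[OF cont]) (use pos D in force)+
  then have "((\<lambda>u. LBINT z=ereal x0..ereal u. 1 / b z) has_vector_derivative 1 / b x)
      (at x within {p..q})"
    by (intro interval_integral_FTC2) (use p in \<open>auto simp: q_def\<close>)
  moreover have "at x within {p..q} = at x"
    by (rule at_within_Icc_at) (use p in \<open>auto simp: q_def\<close>)
  ultimately show ?thesis
    unfolding has_real_derivative_iff_has_vector_derivative B_int_def[abs_def] by simp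
qed

section \<open>Separation of variables\<close>

lemma solution_mono:
  assumes sol: "ode_solution a b t0 x0 y T"
    and a_nonneg: "\<And>t. t0 < t \<Longrightarrow> a t \<ge> 0" and b_nonneg: "\<And>x. b x \<ge> 0"
    and s: "t0 \<le> s" and st: "s \<le> t" and t: "ereal t < T"
  shows "y s \<le> y t"
proof (rule DERIV_nonneg_imp_increasing_open[OF st])
  have below: "ereal u < T" if "u \<le> t" for u
    using that t by (meson ereal_less_eq(3) le_less_trans)
  show "continuous_on {s..t} y"
    using sol s below unfolding ode_solution_def by (auto elim: continuous_on_subset)
  fix u assume u: "s < u" "u < t"
  then have "(y has_real_derivative a u * b (y u)) (at u)"
    using sol s below[of u] unfolding ode_solution_def by auto
  moreover have "a u * b (y u) \<ge> 0"
    using u s a_nonneg b_nonneg by simp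
  ultimately show "\<exists>D. (y has_real_derivative D) (at u) \<and> D \<ge> 0" by blast
qed

text \<open>
  For separating variables it matters only that \<open>A\<close> and \<open>B\<close> are primitives of \<open>a\<close> and \<open>1 / b\<close>. At
  \<open>t0\<close>, where \<open>a\<close> may be singular, continuity of \<open>A\<close> takes the place of differentiability.
\<close>

locale separated_ode =
  fixes a b A B :: "real \<Rightarrow> real" and l :: ereal and t0 x0 :: real
  assumes a_pos: "\<And>t. t0 < t \<Longrightarrow> a t > 0"
    and b_nonneg: "\<And>x. b x \<ge> 0"
    and b_pos: "\<And>x. l < ereal x \<Longrightarrow> b x > 0"
    and x0: "l < ereal x0"
    and A_start: "A t0 = 0"
    and A_cont: "continuous_on {t0..} A"
    and A_deriv: "\<And>t. t0 < t \<Longrightarrow> (A has_real_derivative a t) (at t)"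
    and A_mono: "strict_mono_on {t0..} A"
    and B_start: "B x0 = 0"
    and B_deriv: "\<And>x. l < ereal x \<Longrightarrow> (B has_real_derivative 1 / b x) (at x)"
begin

definition D :: "real set" where "D = {x. l < ereal x}"

definition Binv :: "real \<Rightarrow> real" where "Binv = the_inv_into D B"

lemma D_upward: "x \<in> D \<Longrightarrow> x \<le> z \<Longrightarrow> z \<in> D"
  unfolding D_def by (auto intro: less_le_trans)

lemma above_x0: "x0 \<le> x \<Longrightarrow> x \<in> D"
  using D_upward[of x0] x0 by (simp add: D_def)

lemma open_D: "open D"
  unfolding D_def by (intro open_Collect_less continuous_intros)

lemma B_cont: "continuous_on D B"
  by (intro continuous_at_imp_continuous_on ballI) (auto simp: D_def intro: DERIV_isCont B_deriv)

lemma B_mono: "strict_mono_on D B"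
proof (rule strict_mono_onI)
  fix x z assume xz: "x \<in> D" "z \<in> D" "x < z"
  show "B x < B z"
  proof (rule DERIV_pos_imp_increasing[OF \<open>x < z\<close>])
    fix u assume "x \<le> u" "u \<le> z"
    then have "l < ereal u" using D_upward[of x u] xz by (simp add: D_def)
    then show "\<exists>d. (B has_real_derivative d) (at u) \<and> d > 0"
      using B_deriv[of u] b_pos[of u] by auto
  qed
qed

lemma B_inj: "inj_on B D"
  by (rule strict_mono_on_imp_inj_on[OF B_mono])

lemma Binv_B: "x \<in> D \<Longrightarrow> Binv (B x) = x"
  unfolding Binv_def by (rule the_inv_into_f_f[OF B_inj])

lemma Binv_has_derivative:
  assumes "x \<in> D"
  shows "(Binv has_real_derivative b x) (at (B x))"
  unfolding has_field_derivative_def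
proof (rule has_derivative_inverse_strong[OF open_D assms B_cont Binv_B])
  show "(B has_derivative (*) (1 / b x)) (at x)"
    using assms B_deriv by (simp add: D_def has_field_derivative_def)
  show "(*) (1 / b x) \<circ> (*) (b x) = id"
    using assms b_pos[of x] by (auto simp: D_def fun_eq_iff)
qed

lemma A_nonneg: "t0 \<le> t \<Longrightarrow> A t \<ge> 0"
  using strict_mono_on_leD[OF A_mono, of t0 t] A_start by auto

lemma less_B_infty: "x \<in> D \<Longrightarrow> ereal (B x) < val_at_infty B"
  by (rule less_val_at_infty[of x]) (auto intro: D_upward monotone_on_subset[OF B_mono])

lemma less_B_inftyE:
  assumes "v < val_at_infty B"
  obtains x where "x0 \<le> x" "v < ereal (B x)"
  using less_val_at_inftyE[of x0 B v] monotone_on_subset[OF B_mono] above_x0 assms by blast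

lemma less_A_infty: "t0 \<le> t \<Longrightarrow> ereal (A t) < val_at_infty A"
  by (rule less_val_at_infty[OF A_mono])

lemma less_A_inftyE:
  assumes "v < val_at_infty A"
  obtains t where "t0 \<le> t" "v < ereal (A t)"
  using less_val_at_inftyE[OF A_mono assms] by blast

lemma in_range_B:
  assumes "0 \<le> v" "ereal v < val_at_infty B"
  shows "v \<in> B ` D"
proof -
  obtain X where X: "x0 \<le> X" "ereal v < ereal (B X)"
    using assms(2) by (rule less_B_inftyE)
  have "continuous_on {x0..X} B"
    by (rule continuous_on_subset[OF B_cont]) (auto intro: above_x0)
  then obtain x where "x0 \<le> x" "B x = v"
    using IVT'[of B x0 v X] X assms(1) by (auto simp: B_start)
  then show ?thesis using above_x0 by auto
qed

context
  fixes y T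
  assumes sol: "ode_solution a b t0 x0 y T"
begin

text \<open>
  A solution cannot decrease below its initial value, so \<open>B\<close> may be applied to it.
\<close>

lemma solution_in_D: "t0 \<le> t \<Longrightarrow> ereal t < T \<Longrightarrow> y t \<in> D"
  using solution_mono[OF sol, of t0 t] a_pos b_nonneg sol above_x0
  by (simp add: ode_solution_def less_imp_le)

text \<open>
  The derivative of \<open>B \<circ> y - A\<close> is \<open>a b(y) / b(y) - a = 0\<close>.
\<close>

lemma solution_conserves:
  assumes t: "t0 \<le> t" "ereal t < T"
  shows "B (y t) = A t"
proof (cases "t0 = t")
  case True
  moreover have "y t0 = x0" using sol by (simp add: ode_solution_def)
  ultimately show ?thesis using A_start B_start by simp
next
  case False
  with t have "t0 < t" by simp
  have below: "ereal u < T" if "u \<le> t" for u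
    using that t(2) by (meson ereal_less_eq(3) le_less_trans)
  have "continuous_on {t0..t} y"
    using sol below unfolding ode_solution_def by (auto elim: continuous_on_subset)
  then have "continuous_on {t0..t} (\<lambda>u. B (y u) - A u)"
    using solution_in_D below
    by (intro continuous_intros continuous_on_compose2[OF B_cont] continuous_on_subset[OF A_cont])
       auto
  moreover have "((\<lambda>u. B (y u) - A u) has_real_derivative 0) (at u)" if u: "t0 < u" "u < t" for u
  proof -
    have D: "l < ereal (y u)"
      using solution_in_D[of u] below u by (simp add: D_def)
    have "(y has_real_derivative a u * b (y u)) (at u)"
      using sol below u by (auto simp: ode_solution_def)
    then have "((\<lambda>u. B (y u) - A u) has_real_derivative 1 / b (y u) * (a u * b (y u)) - a u) (at u)"
      using u by (intro DERIV_diff A_deriv DERIV_chain2[where f = B and g = y] B_deriv[OF D])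
    then show ?thesis using b_pos[OF D] by simp
  qed
  ultimately have "B (y t) - A t = B (y t0) - A t0"
    by (intro DERIV_isconst_end[OF \<open>t0 < t\<close>]) auto
  then show ?thesis using sol by (simp add: ode_solution_def A_start B_start)
qed

lemma solution_eq: "t0 \<le> t \<Longrightarrow> ereal t < T \<Longrightarrow> y t = Binv (A t)"
  using Binv_B[OF solution_in_D] solution_conserves by simp

lemma A_less_B_infty: "t0 \<le> t \<Longrightarrow> ereal t < T \<Longrightarrow> ereal (A t) < val_at_infty B"
  using less_B_infty[OF solution_in_D] solution_conserves by simp

end

text \<open>
  \<open>A t\<close> lies between \<open>B x0 = 0\<close> and \<open>B(\<infinity>)\<close>, so it is a value of \<open>B\<close>, and the chain rule applies with
  \<open>(B\<^sup>-\<^sup>1)' = b \<circ> B\<^sup>-\<^sup>1\<close>.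
\<close>

lemma inverse_comp_solves:
  assumes S: "ereal t0 < S"
    and A: "\<And>t. t0 \<le> t \<Longrightarrow> ereal t < S \<Longrightarrow> ereal (A t) < val_at_infty B"
  shows "ode_solution a b t0 x0 (\<lambda>t. Binv (A t)) S"
  unfolding ode_solution_def
proof (intro conjI allI impI)
  have deriv: "(Binv has_real_derivative b (Binv (A t))) (at (A t))"
    if t: "t0 \<le> t" "ereal t < S" for t
  proof -
    obtain x where "x \<in> D" "A t = B x"
      using in_range_B[OF A_nonneg A] t by auto
    then show ?thesis using Binv_has_derivative[of x] Binv_B by simp
  qed
  show "Binv (A t0) = x0"
    using Binv_B[of x0] above_x0[of x0] by (simp add: A_start B_start)
  show "continuous_on {t. t0 \<le> t \<and> ereal t < S} (\<lambda>t. Binv (A t))"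
  proof (rule continuous_on_compose2[where g = Binv and f = A])
    show "continuous_on (A ` {t. t0 \<le> t \<and> ereal t < S}) Binv"
      by (intro continuous_at_imp_continuous_on ballI) (auto intro: DERIV_isCont deriv)
    show "continuous_on {t. t0 \<le> t \<and> ereal t < S} A"
      by (rule continuous_on_subset[OF A_cont]) auto
  qed simp
  fix t assume t: "t0 < t \<and> ereal t < S"
  have "((\<lambda>t. Binv (A t)) has_real_derivative b (Binv (A t)) * a t) (at t)"
    using t by (intro DERIV_chain2[OF deriv A_deriv]) auto
  then show "((\<lambda>t. Binv (A t)) has_real_derivative a t * b (Binv (A t))) (at t)"
    by (simp add: mult.commute)
qed (use S in auto)

section \<open>Maximal solutions and explosion\<close>

context
  fixes y T
  assumes max: "maximal_ode_solution a b t0 x0 y T"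
begin

lemma sol: "ode_solution a b t0 x0 y T"
  using max by (simp add: maximal_ode_solution_def)

text \<open>
  By continuity \<open>A \<tau>\<close> is at most \<open>B(\<infinity>)\<close>; were it smaller, then \<open>A\<close> would stay below \<open>B(\<infinity>)\<close> a
  little beyond \<open>\<tau>\<close>, and \<open>B\<^sup>-\<^sup>1 \<circ> A\<close> would be a longer solution.
\<close>

lemma maximal_solution_end:
  assumes T: "T = ereal \<tau>"
  shows "ereal (A \<tau>) = val_at_infty B"
proof (rule antisym)
  have "t0 < \<tau>" using sol by (simp add: ode_solution_def T)
  then have cont: "isCont A \<tau>" by (intro DERIV_isCont[OF A_deriv])
  show "ereal (A \<tau>) \<le> val_at_infty B"
  proof (rule tendsto_upperbound)
    show "((\<lambda>t. ereal (A t)) \<longlongrightarrow> ereal (A \<tau>)) (at_left \<tau>)"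
      using cont by (intro tendsto_ereal) (auto simp: isCont_def intro: tendsto_within_subset)
    show "eventually (\<lambda>t. ereal (A t) \<le> val_at_infty B) (at_left \<tau>)"
      unfolding eventually_at_left[OF \<open>t0 < \<tau>\<close>]
      using A_less_B_infty[OF sol] T \<open>t0 < \<tau>\<close> by (force intro: less_imp_le)
  qed auto
  show "val_at_infty B \<le> ereal (A \<tau>)"
  proof (rule ccontr)
    assume "\<not> ?thesis"
    then have less: "ereal (A \<tau>) < val_at_infty B" by simp
    then obtain x where x: "x0 \<le> x" "ereal (A \<tau>) < ereal (B x)"
      by (rule less_B_inftyE)
    have "eventually (\<lambda>t. A t < B x) (at_right \<tau>)"
      by (rule order_tendstoD(2)[of _ "A \<tau>"])
         (use cont x in \<open>auto simp: isCont_def intro: tendsto_within_subset\<close>)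
    then obtain \<sigma> where \<sigma>: "\<tau> < \<sigma>" "\<And>t. \<tau> < t \<Longrightarrow> t < \<sigma> \<Longrightarrow> A t < B x"
      unfolding eventually_at_right_field by auto
    have "ode_solution a b t0 x0 (\<lambda>t. Binv (A t)) (ereal \<sigma>)"
    proof (rule inverse_comp_solves)
      fix t assume t: "t0 \<le> t" "ereal t < ereal \<sigma>"
      consider "t < \<tau>" | "t = \<tau>" | "\<tau> < t" by linarith
      then show "ereal (A t) < val_at_infty B"
      proof cases
        case 1
        then show ?thesis using A_less_B_infty[OF sol] T t by simp
      next
        case 2
        then show ?thesis using less by simp
      next
        case 3
        then have "ereal (A t) < ereal (B x)" using \<sigma>(2) t by simp
        also have "\<dots> < val_at_infty B" using x above_x0 by (intro less_B_infty)
        finally show ?thesis .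
      qed
    qed (use \<open>t0 < \<tau>\<close> \<sigma> in auto)
    then have "ereal \<sigma> \<le> T"
      using max solution_eq[OF sol] unfolding maximal_ode_solution_def by auto
    then show False using \<sigma>(1) T by simp
  qed
qed

lemma global_solution:
  assumes "val_at_infty A \<le> val_at_infty B"
  shows "T = \<infinity>"
proof (cases T)
  case (real \<tau>)
  then have "t0 < \<tau>" using sol by (simp add: ode_solution_def)
  then have "ereal (A \<tau>) < val_at_infty A" by (intro less_A_infty) auto
  then show ?thesis using maximal_solution_end[OF real] assms by auto
qed (use sol in \<open>auto simp: ode_solution_def\<close>)

lemma finite_lifetime:
  assumes "val_at_infty B < val_at_infty A"
  obtains \<tau> where "T = ereal \<tau>" "t0 < \<tau>" "ereal (A \<tau>) = val_at_infty B"
proof (cases T)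
  case (real \<tau>)
  then show ?thesis
    using that maximal_solution_end[OF real] sol by (simp add: ode_solution_def)
next
  case PInf
  obtain t where t: "t0 \<le> t" "val_at_infty B < ereal (A t)"
    using assms by (rule less_A_inftyE)
  then show ?thesis using A_less_B_infty[OF sol t(1)] PInf by auto
qed (use sol in \<open>auto simp: ode_solution_def\<close>)

text \<open>
  Given any level \<open>M\<close>, \<open>B M < B(\<infinity>) = A \<tau>\<close>, so close to \<open>\<tau>\<close> one has \<open>B M < A t = B (y t)\<close>,
  that is, \<open>M < y t\<close>.
\<close>

lemma blow_up_at_end:
  assumes T: "T = ereal \<tau>"
  shows "filterlim y at_top (at_left \<tau>)"
  unfolding filterlim_at_top_gt[where c = x0]
proof (intro allI impI)
  fix M assume "x0 < M"
  then have M: "M \<in> D" by (intro above_x0) simp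
  have "t0 < \<tau>" using sol by (simp add: ode_solution_def T)
  have "B M < A \<tau>"
    using less_B_infty[OF M] maximal_solution_end[OF T] by (metis less_ereal.simps(1))
  moreover have "(A \<longlongrightarrow> A \<tau>) (at_left \<tau>)"
    using DERIV_isCont[OF A_deriv[OF \<open>t0 < \<tau>\<close>]]
    by (auto simp: isCont_def intro: tendsto_within_subset)
  ultimately have "eventually (\<lambda>t. B M < A t) (at_left \<tau>)"
    by (intro order_tendstoD(1))
  moreover have "eventually (\<lambda>t. t \<in> {t0<..<\<tau>}) (at_left \<tau>)"
    using eventually_at_left_real[OF \<open>t0 < \<tau>\<close>] .
  ultimately show "eventually (\<lambda>t. M \<le> y t) (at_left \<tau>)"
  proof eventually_elim
    case (elim t)
    then have "B M < B (y t)" "y t \<in> D"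
      using solution_conserves[OF sol] solution_in_D[OF sol] T by auto
    then show ?case
      using strict_mono_on_less_eq[OF B_mono M, of "y t"] by simp
  qed
qed

text \<open>
  Before the end \<open>y\<close> is continuous, hence locally bounded, so no earlier time qualifies.
\<close>

lemma explosion_time_eq_end:
  assumes T: "T = ereal \<tau>"
  shows "explosion_time t0 y T = ereal \<tau>"
proof -
  have "t0 < \<tau>" using sol by (simp add: ode_solution_def T)
  have "\<not> filterlim (\<lambda>u. \<bar>y u\<bar>) at_top (at_left s)" if s: "t0 < s" "s < \<tau>" for s
  proof -
    have "isCont y s"
      using sol s T by (intro DERIV_isCont) (auto simp: ode_solution_def)
    then have "((\<lambda>u. \<bar>y u\<bar>) \<longlongrightarrow> \<bar>y s\<bar>) (at_left s)"
      by (intro tendsto_rabs) (auto simp: isCont_def intro: tendsto_within_subset)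
    then show ?thesis
      using not_tendsto_and_filterlim_at_infinity[of "at_left s" "\<lambda>u. \<bar>y u\<bar>"]
        filterlim_at_top_imp_at_infinity by auto
  qed
  moreover have "filterlim (\<lambda>u. \<bar>y u\<bar>) at_top (at_left \<tau>)"
    by (rule filterlim_compose[OF filterlim_abs_real blow_up_at_end[OF T]])
  ultimately have "{ereal s | s. t0 < s \<and> ereal s \<le> T \<and> filterlim (\<lambda>u. \<bar>y u\<bar>) at_top (at_left s)}
      = {ereal \<tau>}"
    using \<open>t0 < \<tau>\<close> T by (force simp: not_less[symmetric] order.order_iff_strict)
  then show ?thesis
    by (simp add: explosion_time_def)
qed

end

end

theorem lemma7:
  fixes a b y :: "real \<Rightarrow> real" and l T :: ereal and r x0 t0 :: real
  assumes a_pos: "\<And>t. t > 0 \<Longrightarrow> a t > 0"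
    and a_cont: "continuous_on {0<..} a"
    and a_lim: "\<exists>\<eta>::real. \<eta> > 0 \<and> (\<exists>L::ereal. L > 0 \<and>
                  ((\<lambda>t::real. ereal (LBINT s=ereal t..ereal (t + \<eta>). a s)) \<longlongrightarrow> L) at_top)"
    and b_nonneg: "\<And>x. b x \<ge> 0"
    and b_cont: "continuous_on UNIV b"
    and l: "l < \<infinity>"
    and b_pos: "\<And>x. l < ereal x \<Longrightarrow> b x > 0"
    and b_lip: "local_lipschitz (UNIV :: real set) {x. l < ereal x} (\<lambda>_. b)"
    and b_pos_r: "\<And>x. r \<le> x \<Longrightarrow> b x > 0"
    and b_mono_r: "mono_on {r..} b"
    and x0: "l < ereal x0"
    and t0: "t0 \<ge> 0"
    and a_int: "t0 = 0 \<Longrightarrow> \<exists>\<epsilon>::real. \<epsilon> > 0 \<and> set_integrable lborel {0<..<\<epsilon>} a"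
    and y: "maximal_ode_solution a b t0 x0 y T"
  shows "(val_at_infty (B_int b x0) \<ge> val_at_infty (A_int a t0) \<longrightarrow>
            T = \<infinity> \<and>
            (\<forall>t\<ge>t0. A_int a t0 t \<in> B_int b x0 ` {x. l < ereal x} \<and>
                     y t = the_inv_into {x. l < ereal x} (B_int b x0) (A_int a t0 t)))
       \<and> (val_at_infty (B_int b x0) < val_at_infty (A_int a t0) \<longrightarrow>
            explosion_time t0 y T < \<infinity> \<and>
            val_at_infty (B_int b x0) \<in> ereal ` A_int a t0 ` {t0..} \<and>
            explosion_time t0 y T =
              ereal (the_inv_into {t0..} (A_int a t0) (real_of_ereal (val_at_infty (B_int b x0)))))"
proof -
  have cont: "continuous_on {t0<..} a"
    by (rule continuous_on_subset[OF a_cont]) (use t0 in auto)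
  have int: "set_integrable lborel {t0..M} a" for M
  proof (cases "t0 = 0")
    case True
    then show ?thesis using a_int set_integrable_from_origin[OF a_cont] by auto
  next
    case False
    then show ?thesis
      using t0 by (intro borel_integrable_atLeastAtMost' continuous_on_subset[OF a_cont]) auto
  qed
  have pos: "a t > 0" if "t0 < t" for t
    using that t0 a_pos by simp
  interpret separated_ode a b "A_int a t0" "B_int b x0" l t0 x0
    by unfold_locales
       (auto intro: pos b_nonneg b_pos x0 A_int_start A_int_continuous_on int
          A_int_has_derivative cont A_int_strict_mono B_int_start B_int_has_derivative b_cont)
  note sol = sol[OF y]
  show ?thesis
  proof (intro conjI impI)
    assume "val_at_infty (A_int a t0) \<le> val_at_infty (B_int b x0)"
    then show T: "T = \<infinity>" by (rule global_solution[OF y])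
    show "\<forall>t\<ge>t0. A_int a t0 t \<in> B_int b x0 ` {x. l < ereal x} \<and>
        y t = the_inv_into {x. l < ereal x} (B_int b x0) (A_int a t0 t)"
    proof (intro allI impI)
      fix t assume "t0 \<le> t"
      then show "A_int a t0 t \<in> B_int b x0 ` {x. l < ereal x} \<and>
          y t = the_inv_into {x. l < ereal x} (B_int b x0) (A_int a t0 t)"
        using T in_range_B[OF A_nonneg A_less_B_infty[OF sol], of t] solution_eq[OF sol, of t]
        by (simp add: D_def Binv_def)
    qed
  next
    assume "val_at_infty (B_int b x0) < val_at_infty (A_int a t0)"
    then obtain \<tau> where \<tau>: "T = ereal \<tau>" "t0 < \<tau>" "ereal (A_int a t0 \<tau>) = val_at_infty (B_int b x0)"
      by (rule finite_lifetime[OF y])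
    note E = explosion_time_eq_end[OF y \<tau>(1)]
    show "explosion_time t0 y T < \<infinity>" by (simp add: E)
    show "val_at_infty (B_int b x0) \<in> ereal ` A_int a t0 ` {t0..}"
      unfolding \<tau>(3)[symmetric] using \<tau>(2) by auto
    have "the_inv_into {t0..} (A_int a t0) (A_int a t0 \<tau>) = \<tau>"
      using \<tau>(2) by (intro the_inv_into_f_f strict_mono_on_imp_inj_on A_mono) auto
    then show "explosion_time t0 y T =
        ereal (the_inv_into {t0..} (A_int a t0) (real_of_ereal (val_at_infty (B_int b x0))))"
      by (simp add: E \<tau>(3)[symmetric])
  qed
qed

end
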